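(* Let $k\ge1$. A Leibniz algebra $\mathfrak{q}$ over $\mathbb{K}$ is $\mathrm{Lie}$-nilpotent with class of $\mathrm{Lie}$-nilpotency $k$ if and only if $\mathcal{Z}^{\mathrm{Lie}}_k(\mathfrak{q})=\mathfrak{q}$ and $\mathcal{Z}^{\mathrm{Lie}}_{k-1}(\mathfrak{q})\ne\mathfrak{q}$.
   Context: $\mathbb{K}$ is a field with $\frac12\in\mathbb{K}$. A Leibniz algebra is a $\mathbb{K}$-vector space with a bilinear bracket satisfying $[x,[y,z]]=[[x,y],z]-[[x,z],y]$. For two-sided ideals $\mathfrak{m},\mathfrak{n}$ of $\mathfrak{q}$: $[\mathfrak{m},\mathfrak{n}]_{\mathrm{Lie}}$ is the span of all $[m,n]+[n,m]$, $m\in\mathfrak{m}$, $n\in\mathfrak{n}$, and $C^{\mathrm{Lie}}_{\mathfrak{q}}(\mathfrak{m},\mathfrak{n})=\{q\in\mathfrak{q}\mid[q,m]+[m,q]\in\mathfrak{n}\text{ for all }m\in\mathfrak{m}\}$ (both are two-sided ideals of $\mathfrak{q}$). A series of $\mathfrak{q}$ of length $k$ is a finite chain $0=\mathfrak{m}_0\trianglelefteq\mathfrak{m}_1\trianglelefteq\dots\trianglelefteq\mathfrak{m}_k=\mathfrak{q}$ of two-sided ideals of $\mathfrak{q}$; it is $\mathrm{Lie}$-central if $[\mathfrak{m}_i,\mathfrak{q}]_{\mathrm{Lie}}\subseteq\mathfrak{m}_{i-1}$ for $1\le i\le k$. $\mathfrak{q}$ is $\mathrm{Lie}$-nilpotent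 if it has a $\mathrm{Lie}$-central series; the minimal length of such a series is its class of $\mathrm{Lie}$-nilpotency. The upper $\mathrm{Lie}$-central series is $\mathcal{Z}^{\mathrm{Lie}}_0(\mathfrak{q})=0$, $\mathcal{Z}^{\mathrm{Lie}}_i(\mathfrak{q})=C^{\mathrm{Lie}}_{\mathfrak{q}}(\mathfrak{q},\mathcal{Z}^{\mathrm{Lie}}_{i-1}(\mathfrak{q}))$ for $i\ge1$. *)

theory Defs
  imports Complex_Main
begin

text \<open>The underlying vector space of a Leibniz algebra is the whole type \<open>'q\<close>, with
  scalar multiplication \<open>scale\<close> by the field \<open>'k\<close>.\<close>

locale leibniz_algebra = vector_space scale
  for scale :: "'k::field \<Rightarrow> 'q::ab_group_add \<Rightarrow> 'q" +
  fixes bracket :: "'q \<Rightarrow> 'q \<Rightarrow> 'q"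
  assumes linear_bracket_left: "Vector_Spaces.linear scale scale (\<lambda>x. bracket x y)"
    and linear_bracket_right: "Vector_Spaces.linear scale scale (\<lambda>y. bracket x y)"
    and leibniz_identity:
      "bracket x (bracket y z) = bracket (bracket x y) z - bracket (bracket x z) y"
begin

definition two_sided_ideal :: "'q set \<Rightarrow> bool" where
  "two_sided_ideal I \<longleftrightarrow>
     subspace I \<and> (\<forall>x\<in>I. \<forall>q. bracket x q \<in> I \<and> bracket q x \<in> I)"

definition lie_commutator :: "'q set \<Rightarrow> 'q set \<Rightarrow> 'q set" where
  "lie_commutator M N = span {bracket m n + bracket n m | m n. m \<in> M \<and> n \<in> N}"

definition lie_centralizer :: "'q set \<Rightarrow> 'q set \<Rightarrow> 'q set" where
  "lie_centralizer M N = {q. \<forall>m\<in>M. bracket q m + bracket m q \<in> N}"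

text \<open>A series of length \<open>k\<close> is given by a function on \<open>nat\<close> of which only the values at
  \<open>0, \<dots>, k\<close> matter. The inclusions need not be strict, and each term is an ideal of the whole
  algebra (hence of the next term).\<close>

definition ideal_series :: "nat \<Rightarrow> (nat \<Rightarrow> 'q set) \<Rightarrow> bool" where
  "ideal_series k M \<longleftrightarrow>
     M 0 = {0} \<and> M k = UNIV \<and>
     (\<forall>i\<le>k. two_sided_ideal (M i)) \<and> (\<forall>i<k. M i \<subseteq> M (Suc i))"

definition lie_central_series :: "nat \<Rightarrow> (nat \<Rightarrow> 'q set) \<Rightarrow> bool" where
  "lie_central_series k M \<longleftrightarrow>
     ideal_series k M \<and> (\<forall>i\<in>{1..k}. lie_commutator (M i) UNIV \<subseteq> M (i - 1))"

definition lie_nilpotent :: bool where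
  "lie_nilpotent \<longleftrightarrow> (\<exists>k M. lie_central_series k M)"

text \<open>Meaningful only under \<open>lie_nilpotent\<close>; otherwise the value is unspecified.\<close>

definition lie_nilpotency_class :: nat where
  "lie_nilpotency_class = (LEAST k. \<exists>M. lie_central_series k M)"

primrec upper_lie_central :: "nat \<Rightarrow> 'q set" where
  "upper_lie_central 0 = {0}"
| "upper_lie_central (Suc i) = lie_centralizer UNIV (upper_lie_central i)"

end

end

theory Submission
  imports Defs
begin

text \<open>The upper Lie-central series \<open>Z\<close> climbs at least as fast as any Lie-central series \<open>M\<close>: if
  \<open>M i \<subseteq> Z i\<close>, then symmetrised brackets of elements of \<open>M (Suc i)\<close> with arbitrary elements lie
  in \<open>M i\<close> and hence in \<open>Z i\<close>, which is what \<open>M (Suc i) \<subseteq> Z (Suc i)\<close> demands (lemma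
  \<open>lie_central_series_below_upper\<close>). Hence a series of length \<open>n\<close> exists only if \<open>Z n\<close> is
  everything. Conversely, once \<open>Z n\<close> is everything, the upper series itself is a Lie-central
  series of length \<open>n\<close>, provided its terms form an increasing chain of ideals. This is where the
  Leibniz identity enters: it says that right multiplications are derivations, which makes the
  Lie-centralizer of the algebra modulo an ideal again an ideal (lemma
  \<open>two_sided_ideal_lie_centralizer\<close>).

  So the class is the first index at which the upper series reaches the whole algebra; since the
  series is increasing, that index is \<open>k \<ge> 1\<close> exactly when the series is full at \<open>k\<close> but not at
  \<open>k - 1\<close>.\<close>

context leibniz_algebra
begin

lemma bracket_add_left: "bracket (x + y) z = bracket x z + bracket y z"
  using linear_bracket_left[of z] by (simp add: Vector_Spaces.linear_iff)

lemma bracket_add_right: "bracket x (y + z) = bracket x y + bracket x z"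
  using linear_bracket_right[of x] by (simp add: Vector_Spaces.linear_iff)

lemma bracket_scale_left: "bracket (scale c x) y = scale c (bracket x y)"
  using linear_bracket_left[of y] by (simp add: Vector_Spaces.linear_iff)

lemma bracket_scale_right: "bracket x (scale c y) = scale c (bracket x y)"
  using linear_bracket_right[of x] by (simp add: Vector_Spaces.linear_iff)

lemma bracket_zero_left [simp]: "bracket 0 x = 0"
  using bracket_add_left[of 0 0 x] by simp

lemma bracket_zero_right [simp]: "bracket x 0 = 0"
  using bracket_add_right[of x 0 0] by simp

lemma two_sided_ideal_zero: "two_sided_ideal {0}"
  by (simp add: two_sided_ideal_def)

lemma ideal_subset_lie_centralizer:
  assumes "two_sided_ideal N"
  shows "N \<subseteq> lie_centralizer UNIV N"
  using assms by (auto simp: two_sided_ideal_def lie_centralizer_def intro: subspace_add)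

text \<open>Write \<open>s a b = [a, b] + [b, a]\<close>. Right multiplication by \<open>p\<close> is a derivation for the bracket,
  hence for \<open>s\<close>; this is the Leibniz identity applied to both summands.\<close>

lemma symmetrized_bracket_derivation:
  "bracket (bracket q p) m + bracket m (bracket q p) =
     bracket (bracket q m + bracket m q) p
       - (bracket q (bracket m p) + bracket (bracket m p) q)"
  by (simp add: bracket_add_left leibniz_identity[of q m p] leibniz_identity[of m q p])

text \<open>Only closure under brackets is not formal. For \<open>[q, p]\<close> it is read off the derivation rule,
  both of whose right-hand terms lie in \<open>N\<close>. For \<open>[p, q]\<close> no second computation is needed, since
  it differs from \<open>- [q, p]\<close> by an element of \<open>N\<close>, and \<open>N\<close> is contained in the centralizer.\<close>

lemma two_sided_ideal_lie_centralizer: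
  assumes N: "two_sided_ideal N"
  shows "two_sided_ideal (lie_centralizer UNIV N)"
proof -
  let ?C = "lie_centralizer UNIV N"
  have sub: "subspace N" and closed: "\<And>x p. x \<in> N \<Longrightarrow> bracket x p \<in> N"
    using N by (auto simp: two_sided_ideal_def)
  have C: "subspace ?C"
  proof (rule subspaceI)
    show "0 \<in> ?C"
      using sub by (simp add: lie_centralizer_def subspace_0)
  next
    fix x y assume "x \<in> ?C" "y \<in> ?C"
    then have "(bracket x m + bracket m x) + (bracket y m + bracket m y) \<in> N" for m
      using sub by (auto simp: lie_centralizer_def intro: subspace_add)
    then show "x + y \<in> ?C"
      by (simp add: lie_centralizer_def bracket_add_left bracket_add_right algebra_simps)
  next
    fix c x assume "x \<in> ?C"
    then have "scale c (bracket x m + bracket m x) \<in> N" for m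
      using sub by (auto simp: lie_centralizer_def intro: subspace_scale)
    then show "scale c x \<in> ?C"
      by (simp add: lie_centralizer_def bracket_scale_left bracket_scale_right scale_right_distrib)
  qed
  have "bracket q p \<in> ?C \<and> bracket p q \<in> ?C" if "q \<in> ?C" for q p
  proof
    have s: "bracket q m + bracket m q \<in> N" for m
      using that by (simp add: lie_centralizer_def)
    show qp: "bracket q p \<in> ?C"
      using subspace_diff[OF sub closed[OF s] s]
      by (simp add: lie_centralizer_def symmetrized_bracket_derivation)
    have "bracket q p + bracket p q \<in> ?C"
      using s ideal_subset_lie_centralizer[OF N] by blast
    then have "(bracket q p + bracket p q) - bracket q p \<in> ?C"
      using qp by (rule subspace_diff[OF C])
    then show "bracket p q \<in> ?C" by simp
  qed
  with C show ?thesis by (simp add: two_sided_ideal_def)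
qed

lemma two_sided_ideal_upper_lie_central: "two_sided_ideal (upper_lie_central i)"
  by (induction i) (auto intro: two_sided_ideal_zero two_sided_ideal_lie_centralizer)

lemma mono_upper_lie_central: "mono upper_lie_central"
  by (simp add: mono_iff_le_Suc ideal_subset_lie_centralizer two_sided_ideal_upper_lie_central)

text \<open>Central series are defined through commutators, the upper series through centralizers; this
  adjunction translates one condition into the other.\<close>

lemma lie_commutator_subset_iff:
  assumes "subspace N"
  shows "lie_commutator M L \<subseteq> N \<longleftrightarrow> M \<subseteq> lie_centralizer L N"
proof -
  have "lie_commutator M L \<subseteq> N \<longleftrightarrow>
      {bracket m n + bracket n m | m n. m \<in> M \<and> n \<in> L} \<subseteq> N"
    unfolding lie_commutator_def using assms span_minimal span_superset by (meson subset_trans)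
  then show ?thesis
    by (auto simp: lie_centralizer_def)
qed

lemma lie_central_series_below_upper:
  assumes "lie_central_series n M" and "i \<le> n"
  shows "M i \<subseteq> upper_lie_central i"
  using \<open>i \<le> n\<close>
proof (induction i)
  case 0
  then show ?case
    using assms(1) by (simp add: lie_central_series_def ideal_series_def)
next
  case (Suc i)
  have "lie_commutator (M (Suc i)) UNIV \<subseteq> M i"
    using assms(1) Suc.prems by (force simp: lie_central_series_def)
  also have "\<dots> \<subseteq> upper_lie_central i"
    using Suc by simp
  finally show ?case
    using two_sided_ideal_upper_lie_central[of i]
    by (simp add: lie_commutator_subset_iff two_sided_ideal_def)
qed

lemma lie_central_series_upper:
  assumes "upper_lie_central n = UNIV"
  shows "lie_central_series n upper_lie_central"
proof -
  have "lie_commutator (upper_lie_central i) UNIV \<subseteq> upper_lie_central (i - 1)"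
    if i: "i \<in> {1..n}" for i
  proof -
    obtain j where "i = Suc j"
      using i by (cases i) auto
    then show ?thesis
      using two_sided_ideal_upper_lie_central[of j]
      by (simp add: lie_commutator_subset_iff two_sided_ideal_def)
  qed
  moreover have "ideal_series n upper_lie_central"
    using assms two_sided_ideal_upper_lie_central monoD[OF mono_upper_lie_central, OF le_SucI]
    by (simp add: ideal_series_def del: upper_lie_central.simps(2))
  ultimately show ?thesis
    by (simp add: lie_central_series_def)
qed

lemma ex_lie_central_series_iff:
  "(\<exists>M. lie_central_series n M) \<longleftrightarrow> upper_lie_central n = UNIV"
proof
  assume "\<exists>M. lie_central_series n M"
  then obtain M where M: "lie_central_series n M" ..
  then have "M n = UNIV"
    by (simp add: lie_central_series_def ideal_series_def)
  with lie_central_series_below_upper[OF M, of n] show "upper_lie_central n = UNIV"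
    by auto
qed (blast intro: lie_central_series_upper)

lemma upper_lie_central_eq_UNIV_mono:
  "upper_lie_central i = UNIV \<Longrightarrow> i \<le> j \<Longrightarrow> upper_lie_central j = UNIV"
  using monoD[OF mono_upper_lie_central] by blast

lemma lie_nilpotency_class_eq_iff:
  assumes "k \<ge> 1"
  shows "lie_nilpotent \<and> lie_nilpotency_class = k \<longleftrightarrow>
    upper_lie_central k = UNIV \<and> upper_lie_central (k - 1) \<noteq> UNIV"
proof -
  have nil: "lie_nilpotent \<longleftrightarrow> (\<exists>n. upper_lie_central n = UNIV)"
    and cls: "lie_nilpotency_class = (LEAST n. upper_lie_central n = UNIV)"
    by (simp_all add: lie_nilpotent_def lie_nilpotency_class_def ex_lie_central_series_iff)
  show ?thesis
  proof
    assume "lie_nilpotent \<and> lie_nilpotency_class = k"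
    then obtain n where n: "upper_lie_central n = UNIV"
      and k: "(LEAST n. upper_lie_central n = UNIV) = k"
      using nil cls by auto
    have "upper_lie_central k = UNIV"
      using LeastI[of "\<lambda>n. upper_lie_central n = UNIV", OF n] unfolding k .
    moreover have "upper_lie_central (k - 1) \<noteq> UNIV"
      using not_less_Least[of "k - 1" "\<lambda>n. upper_lie_central n = UNIV"] assms unfolding k by simp
    ultimately show "upper_lie_central k = UNIV \<and> upper_lie_central (k - 1) \<noteq> UNIV" ..
  next
    assume full: "upper_lie_central k = UNIV \<and> upper_lie_central (k - 1) \<noteq> UNIV"
    have "k \<le> n" if "upper_lie_central n = UNIV" for n
    proof (rule ccontr)
      assume "\<not> k \<le> n"
      then have "n \<le> k - 1" by simp
      with that full show False
        using upper_lie_central_eq_UNIV_mono by blast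
    qed
    with full have "(LEAST n. upper_lie_central n = UNIV) = k"
      by (intro Least_equality) auto
    with full nil cls show "lie_nilpotent \<and> lie_nilpotency_class = k" by auto
  qed
qed

end

theorem theorem5p13:
  fixes scale :: "'k::field \<Rightarrow> 'q::ab_group_add \<Rightarrow> 'q"
    and bracket :: "'q \<Rightarrow> 'q \<Rightarrow> 'q"
    and k :: nat
  assumes "(2::'k) \<noteq> 0"
    and "leibniz_algebra scale bracket"
    and "k \<ge> 1"
  shows "leibniz_algebra.lie_nilpotent scale bracket
           \<and> leibniz_algebra.lie_nilpotency_class scale bracket = k
         \<longleftrightarrow> leibniz_algebra.upper_lie_central bracket k = UNIV
           \<and> leibniz_algebra.upper_lie_central bracket (k - 1) \<noteq> UNIV"
  using assms(2,3) by (rule leibniz_algebra.lie_nilpotency_class_eq_iff)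

end
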